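(* Let $E$ be a Dedekind complete Riesz space with a strictly positive conditional expectation operator $T$ and a weak order unit $e=Te$. Let $(P_n)_{n\ge1}$ be a sequence of band projections on $E$ such that $\liminf_{n\to\infty}T(P_ne)=0$ and $\sum_{n=1}^\infty T\big(P_n(I-P_{n+1})e\big)$ is (order) convergent in $E$. Then $\limsup_{n\to\infty}P_n=0$.
   Context: A conditional expectation operator on a Dedekind complete Riesz space $E$ with weak order unit is a positive order continuous linear projection $T:E\to E$ (so $T^2=T$) whose range $R(T)$ is a Dedekind complete Riesz subspace of $E$, and such that $T(u)$ is a weak order unit of $E$ for each weak order unit $u$ of $E$. $T$ is strictly positive if $f\ge0$ and $Tf=0$ imply $f=0$. $I$ is the identity operator on $E$; products of band projections are compositions. For an order bounded sequence $(f_n)$ in $E$, $\liminf_{n\to\infty}f_n=\sup_{k}\inf_{n\ge k}f_n$ and $\limsup_{n\to\infty}f_n=\inf_k\sup_{n\ge k}f_n$. The sequence converges in order iff these agree, and the common value is its order limit. A series is order convergent if its sequence of partial sums is order convergent in $E$. Band projections are ordered as operators ($P\le Q$ iff $Pf\le Qf$ for all $f\ge0$); they form a complete Boolean algebra because $E$ is Dedekind complete, and $\limsup_{n\to\infty}P_n=\bigwedge_{k\ge1}\bigvee_{n\ge k}P_n$. *)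

theory Defs
  imports Complex_Main "HOL-Library.Lattice_Algebras"
begin

text \<open>
  The Riesz space \<open>E\<close> is the universe of a type. The class
  \<^class>\<open>conditionally_complete_lattice\<close> says exactly that nonempty order bounded sets have
  suprema and infima, i.e. Dedekind completeness; \<^class>\<open>lattice_ab_group_add_abs\<close> fixes
  \<open>\<bar>f\<bar> = sup f (- f)\<close>.
\<close>

class riesz_space = ordered_real_vector + lattice_ab_group_add_abs

class dedekind_complete_riesz_space = riesz_space + conditionally_complete_lattice


subsection \<open>Bands and weak order units\<close>

definition order_ideal :: "'a::riesz_space set \<Rightarrow> bool" where
  "order_ideal A \<longleftrightarrow> subspace A \<and> (\<forall>f g. g \<in> A \<and> \<bar>f\<bar> \<le> \<bar>g\<bar> \<longrightarrow> f \<in> A)"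

text \<open>
  A band is an ideal containing the supremum of each of its subsets whenever that supremum exists
  in \<open>E\<close>; by Dedekind completeness it exists for every nonempty subset bounded above.
\<close>

definition band :: "'a::dedekind_complete_riesz_space set \<Rightarrow> bool" where
  "band B \<longleftrightarrow> order_ideal B \<and>
     (\<forall>D. D \<subseteq> B \<and> D \<noteq> {} \<and> bdd_above D \<longrightarrow> Sup D \<in> B)"

definition disjoint_complement :: "'a::riesz_space set \<Rightarrow> 'a set" where
  "disjoint_complement B = {f. \<forall>g\<in>B. inf \<bar>f\<bar> \<bar>g\<bar> = 0}"

text \<open>
  The band generated by \<open>u\<close> is all of \<open>E\<close>. Unless \<open>E = {0}\<close>, this forces \<open>u \<noteq> 0\<close>.
\<close>

definition weak_order_unit :: "'a::dedekind_complete_riesz_space \<Rightarrow> bool" where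
  "weak_order_unit u \<longleftrightarrow> 0 \<le> u \<and> band hull {u} = UNIV"


subsection \<open>Order limits of sequences\<close>

text \<open>
  Sequences are indexed from 0. The first two definitions are meaningful for order bounded
  sequences only.
\<close>

definition order_liminf :: "(nat \<Rightarrow> 'a::conditionally_complete_lattice) \<Rightarrow> 'a" where
  "order_liminf f = (SUP k. INF n\<in>{k..}. f n)"

definition order_limsup :: "(nat \<Rightarrow> 'a::conditionally_complete_lattice) \<Rightarrow> 'a" where
  "order_limsup f = (INF k. SUP n\<in>{k..}. f n)"

definition order_convergent :: "(nat \<Rightarrow> 'a::conditionally_complete_lattice) \<Rightarrow> bool" where
  "order_convergent f \<longleftrightarrow>
     bdd_below (range f) \<and> bdd_above (range f) \<and> order_liminf f = order_limsup f"

definition order_summable :: "(nat \<Rightarrow> 'a::dedekind_complete_riesz_space) \<Rightarrow> bool" where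
  "order_summable f \<longleftrightarrow> order_convergent (\<lambda>N. \<Sum>n\<le>N. f n)"


subsection \<open>Conditional expectation operators\<close>

definition positive_operator :: "('a::riesz_space \<Rightarrow> 'a) \<Rightarrow> bool" where
  "positive_operator T \<longleftrightarrow> linear T \<and> (\<forall>f\<ge>0. 0 \<le> T f)"

text \<open>
  Order continuity of a positive operator: \<open>D \<down> 0\<close> implies \<open>T D \<down> 0\<close> for downward directed
  sets \<open>D\<close> (equivalently, for decreasing nets).
\<close>

definition order_continuous :: "('a::dedekind_complete_riesz_space \<Rightarrow> 'a) \<Rightarrow> bool" where
  "order_continuous T \<longleftrightarrow>
     (\<forall>D. D \<noteq> {} \<and> (\<forall>f\<in>D. \<forall>g\<in>D. \<exists>h\<in>D. h \<le> f \<and> h \<le> g) \<and> bdd_below D \<and> Inf D = 0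
        \<longrightarrow> Inf (T ` D) = 0)"

definition riesz_subspace :: "'a::riesz_space set \<Rightarrow> bool" where
  "riesz_subspace S \<longleftrightarrow> subspace S \<and> (\<forall>f\<in>S. \<forall>g\<in>S. sup f g \<in> S \<and> inf f g \<in> S)"

text \<open>
  Dedekind completeness of a subspace \<open>S\<close> as a Riesz space in its own right: upper bounds and
  suprema are taken within \<open>S\<close>.
\<close>

definition dedekind_complete_on :: "'a::order set \<Rightarrow> bool" where
  "dedekind_complete_on S \<longleftrightarrow>
     (\<forall>A. A \<subseteq> S \<and> A \<noteq> {} \<and> (\<exists>u\<in>S. \<forall>a\<in>A. a \<le> u) \<longrightarrow>
        (\<exists>s\<in>S. (\<forall>a\<in>A. a \<le> s) \<and> (\<forall>u\<in>S. (\<forall>a\<in>A. a \<le> u) \<longrightarrow> s \<le> u)))"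

definition conditional_expectation :: "('a::dedekind_complete_riesz_space \<Rightarrow> 'a) \<Rightarrow> bool" where
  "conditional_expectation T \<longleftrightarrow>
     positive_operator T \<and> order_continuous T \<and> T \<circ> T = T \<and>
     riesz_subspace (range T) \<and> dedekind_complete_on (range T) \<and>
     (\<forall>u. weak_order_unit u \<longrightarrow> weak_order_unit (T u))"

definition strictly_positive :: "('a::riesz_space \<Rightarrow> 'a) \<Rightarrow> bool" where
  "strictly_positive T \<longleftrightarrow> positive_operator T \<and> (\<forall>f\<ge>0. T f = 0 \<longrightarrow> f = 0)"


subsection \<open>Band projections\<close>

text \<open>
  \<open>P\<close> is the projection onto a band \<open>B\<close> along its disjoint complement. Since
  \<open>B \<inter> disjoint_complement B = {0}\<close>, the band determines \<open>P\<close>, and \<open>P\<close> is automatically linear.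
\<close>

definition band_projection :: "('a::dedekind_complete_riesz_space \<Rightarrow> 'a) \<Rightarrow> bool" where
  "band_projection P \<longleftrightarrow>
     (\<exists>B. band B \<and> (\<forall>f. P f \<in> B \<and> f - P f \<in> disjoint_complement B))"

definition operator_le :: "('a::riesz_space \<Rightarrow> 'a) \<Rightarrow> ('a \<Rightarrow> 'a) \<Rightarrow> bool" where
  "operator_le P Q \<longleftrightarrow> (\<forall>f\<ge>0. P f \<le> Q f)"

text \<open>
  Suprema and infima in the partially ordered set of band projections, which is a complete
  Boolean algebra; in particular both descriptions below always denote for sets of band projections.
\<close>

definition band_projection_Sup ::
    "('a::dedekind_complete_riesz_space \<Rightarrow> 'a) set \<Rightarrow> 'a \<Rightarrow> 'a" where
  "band_projection_Sup \<P> = (THE Q. band_projection Q \<and> (\<forall>P\<in>\<P>. operator_le P Q) \<and>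
     (\<forall>R. band_projection R \<and> (\<forall>P\<in>\<P>. operator_le P R) \<longrightarrow> operator_le Q R))"

definition band_projection_Inf ::
    "('a::dedekind_complete_riesz_space \<Rightarrow> 'a) set \<Rightarrow> 'a \<Rightarrow> 'a" where
  "band_projection_Inf \<P> = (THE Q. band_projection Q \<and> (\<forall>P\<in>\<P>. operator_le Q P) \<and>
     (\<forall>R. band_projection R \<and> (\<forall>P\<in>\<P>. operator_le R P) \<longrightarrow> operator_le R Q))"

definition band_projection_limsup ::
    "(nat \<Rightarrow> 'a::dedekind_complete_riesz_space \<Rightarrow> 'a) \<Rightarrow> 'a \<Rightarrow> 'a" where
  "band_projection_limsup P = band_projection_Inf (range (\<lambda>k. band_projection_Sup (P ` {k..})))"

end

theory Submission
  imports Defs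
begin

text \<open>
  Write \<open>p\<^sub>n = P\<^sub>n e\<close> and \<open>d\<^sub>n = P\<^sub>n (e - p\<^sub>n\<^sub>+\<^sub>1)\<close>. What \<open>P\<^sub>n\<close> keeps of \<open>e\<close> either is kept by
  \<open>P\<^sub>n\<^sub>+\<^sub>1\<close> too or is counted in \<open>d\<^sub>n\<close>, that is \<open>p\<^sub>n \<le> d\<^sub>n + p\<^sub>n\<^sub>+\<^sub>1\<close>. Iterating, since \<open>d\<^sub>j \<ge> 0\<close>, every \<open>p\<^sub>n\<close> with
  \<open>k \<le> n \<le> m\<close>, and hence their supremum, is at most \<open>d\<^sub>k + \<dots> + d\<^sub>m\<^sub>-\<^sub>1 + p\<^sub>m\<close>. Now apply \<open>T\<close>: the sum
  contributes at most the tail \<open>r\<^sub>k\<close> of the convergent series, whatever \<open>m\<close> is, and since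
  \<open>liminf T p\<^sub>m = 0\<close> the last term disappears when \<open>m\<close> grows. Order continuity of \<open>T\<close> then gives
  \<open>T (sup\<^sub>n\<^sub>\<ge>\<^sub>k p\<^sub>n) \<le> r\<^sub>k\<close>. As \<open>r\<^sub>k\<close> decreases to \<open>0\<close>, strict positivity forces
  \<open>inf\<^sub>k sup\<^sub>n\<^sub>\<ge>\<^sub>k p\<^sub>n = 0\<close>; this is \<open>limsup_components_eq_0\<close>.

  It remains to pass from components of \<open>e\<close> to operators. Suprema of band projections are
  computed pointwise on the positive cone (\<open>band_projection_Sup_apply\<close>), so a band projection
  \<open>R\<close> below \<open>\<Or>\<^sub>n\<^sub>\<ge>\<^sub>k P\<^sub>n\<close> for all \<open>k\<close> satisfies \<open>R e \<le> inf\<^sub>k sup\<^sub>n\<^sub>\<ge>\<^sub>k p\<^sub>n = 0\<close>, and a band projection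
  that kills a weak order unit is zero.
\<close>

section \<open>Disjointness in Riesz spaces\<close>

lemma eq_diff_pos_neg:
  fixes f :: "'a::lattice_ab_group_add"
  shows "f = sup f 0 - sup (- f) 0"
proof -
  have "f + sup (- f) 0 = sup 0 f"
    by (simp add: add_sup_distrib_left)
  then show ?thesis
    by (metis add_diff_cancel_right' sup.commute)
qed

lemma inf_add_le_add_inf:
  fixes x y z :: "'a::lattice_ab_group_add_abs"
  assumes "0 \<le> x" "0 \<le> y" "0 \<le> z"
  shows "inf (x + y) z \<le> inf x z + inf y z"
proof -
  have "inf x z + inf y z = inf (inf (x + y) (z + y)) (inf (x + z) (z + z))"
    by (simp add: add_inf_distrib_left add_inf_distrib_right)
  moreover have "z \<le> z + y" "z \<le> x + z" "z \<le> z + z"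
    using assms by simp_all
  ultimately show ?thesis
    by (auto intro: le_infI1 le_infI2)
qed

text \<open>
  Scaling both arguments by \<open>c\<close> is an order automorphism, which reduces unequal scalings to
  equal ones.
\<close>

lemma inf_scaleR_eq_0:
  fixes x y :: "'a::riesz_space"
  assumes "0 \<le> x" "0 \<le> y" "inf x y = 0" "0 \<le> c"
  shows "inf (c *\<^sub>R x) y = 0"
proof (rule antisym)
  define C where "C = max c 1"
  have C: "0 < C" "c \<le> C" "1 \<le> C" by (auto simp: C_def)
  let ?w = "inf (c *\<^sub>R x) y"
  have "?w \<le> C *\<^sub>R x"
    using C assms by (meson inf_le1 order_trans scaleR_right_mono)
  moreover have "?w \<le> C *\<^sub>R y"
    using scaleR_right_mono[OF C(3) assms(2)] by (simp add: le_infI2)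
  ultimately have "inverse C *\<^sub>R ?w \<le> x" "inverse C *\<^sub>R ?w \<le> y"
    using C by (simp_all add: pos_divideR_le_eq)
  then have "inverse C *\<^sub>R ?w \<le> 0"
    using assms(3) by (metis le_inf_iff)
  then show "?w \<le> 0"
    using C by (simp add: pos_divideR_le_eq)
  show "0 \<le> ?w"
    using assms by (simp add: scaleR_nonneg_nonneg)
qed

lemma abs_scaleR_le:
  fixes f :: "'a::riesz_space"
  shows "\<bar>c *\<^sub>R f\<bar> \<le> \<bar>c\<bar> *\<^sub>R \<bar>f\<bar>"
proof (cases "0 \<le> c")
  case True
  have "c *\<^sub>R f \<le> c *\<^sub>R \<bar>f\<bar>" "c *\<^sub>R (- f) \<le> c *\<^sub>R \<bar>f\<bar>"
    using True by (intro scaleR_left_mono abs_ge_self abs_ge_minus_self; simp)+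
  then show ?thesis
    using True by (auto intro: abs_leI)
next
  case False
  have "(- c) *\<^sub>R f \<le> (- c) *\<^sub>R \<bar>f\<bar>" "(- c) *\<^sub>R (- f) \<le> (- c) *\<^sub>R \<bar>f\<bar>"
    using False by (intro scaleR_left_mono abs_ge_self abs_ge_minus_self; simp)+
  then show ?thesis
    using False by (auto intro: abs_leI)
qed

lemma disjoint_complement_mono:
  assumes "g \<in> disjoint_complement S" "\<bar>f\<bar> \<le> \<bar>g\<bar>"
  shows "f \<in> disjoint_complement S"
  unfolding disjoint_complement_def
proof (intro CollectI ballI antisym)
  fix h assume "h \<in> S"
  then have "inf \<bar>g\<bar> \<bar>h\<bar> = 0"
    using assms(1) by (simp add: disjoint_complement_def)
  then show "inf \<bar>f\<bar> \<bar>h\<bar> \<le> 0"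
    by (metis assms(2) inf_mono order_refl)
qed simp

lemma subspace_disjoint_complement: "subspace (disjoint_complement S)"
proof (rule subspaceI)
  show "0 \<in> disjoint_complement S"
    by (simp add: disjoint_complement_def inf.absorb1)
next
  fix f g assume *: "f \<in> disjoint_complement S" "g \<in> disjoint_complement S"
  show "f + g \<in> disjoint_complement S"
    unfolding disjoint_complement_def
  proof (intro CollectI ballI antisym)
    fix h assume "h \<in> S"
    then have 0: "inf \<bar>f\<bar> \<bar>h\<bar> = 0" "inf \<bar>g\<bar> \<bar>h\<bar> = 0"
      using * by (auto simp: disjoint_complement_def)
    have "inf (\<bar>f + g\<bar>) (\<bar>h\<bar>) \<le> inf (\<bar>f\<bar> + \<bar>g\<bar>) \<bar>h\<bar>"
      by (intro inf_mono abs_triangle_ineq order_refl)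
    also have "\<dots> \<le> inf (\<bar>f\<bar>) (\<bar>h\<bar>) + inf (\<bar>g\<bar>) (\<bar>h\<bar>)"
      by (rule inf_add_le_add_inf) simp_all
    finally show "inf (\<bar>f + g\<bar>) (\<bar>h\<bar>) \<le> 0"
      by (simp add: 0)
  qed simp
next
  fix c f assume *: "f \<in> disjoint_complement S"
  show "c *\<^sub>R f \<in> disjoint_complement S"
    unfolding disjoint_complement_def
  proof (intro CollectI ballI antisym)
    fix h assume "h \<in> S"
    then have "inf \<bar>f\<bar> \<bar>h\<bar> = 0"
      using * by (auto simp: disjoint_complement_def)
    then have "inf (\<bar>c\<bar> *\<^sub>R \<bar>f\<bar>) \<bar>h\<bar> = 0"
      by (intro inf_scaleR_eq_0) simp_all
    then show "inf (\<bar>c *\<^sub>R f\<bar>) (\<bar>h\<bar>) \<le> 0"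
      by (metis abs_scaleR_le inf_mono order_refl)
  qed simp
qed

text \<open>
  Closure under suprema rests on \<open>x + h = sup x h + inf x h\<close>: disjointness of \<open>x\<close> and \<open>h\<close> says
  that \<open>x + h \<le> sup x h\<close>, and in the form \<open>x \<le> sup s h - h\<close>, where \<open>s\<close> is any element above \<open>x\<close>,
  this is an upper bound that the supremum inherits.
\<close>

lemma band_disjoint_complement:
  fixes S :: "'a::dedekind_complete_riesz_space set"
  shows "band (disjoint_complement S)"
  unfolding band_def
proof (intro conjI allI impI)
  show "order_ideal (disjoint_complement S)"
    using subspace_disjoint_complement disjoint_complement_mono
    by (auto simp: order_ideal_def)
next
  fix D assume "D \<subseteq> disjoint_complement S \<and> D \<noteq> {} \<and> bdd_above D"
  then have D: "D \<subseteq> disjoint_complement S" "D \<noteq> {}" "bdd_above D" by auto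
  obtain d0 where d0: "d0 \<in> D" using D by auto
  let ?s = "sup (Sup D) 0"
  have pos: "?s \<in> disjoint_complement S"
    unfolding disjoint_complement_def
  proof (intro CollectI ballI antisym)
    fix g assume g: "g \<in> S"
    let ?h = "\<bar>g\<bar>"
    have "d \<le> sup ?s ?h - ?h" if d: "d \<in> D" for d
    proof -
      have "sup d 0 \<le> \<bar>d\<bar>"
        by (simp add: abs_ge_self)
      then have "inf (sup d 0) ?h \<le> inf \<bar>d\<bar> ?h"
        by (rule inf_mono) simp
      also have "\<dots> = 0"
        using D(1) d g by (auto simp: disjoint_complement_def)
      finally have "sup d 0 + ?h \<le> sup (sup d 0) ?h"
        using add_eq_inf_sup[of "sup d 0" ?h] by simp
      also have "\<dots> \<le> sup ?s ?h"
        by (intro sup_mono cSup_upper d D order_refl)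
      finally have "sup d 0 \<le> sup ?s ?h - ?h"
        by (simp add: le_diff_eq)
      then show ?thesis
        by (rule order_trans[OF sup_ge1])
    qed
    then have "Sup D \<le> sup ?s ?h - ?h"
      by (intro cSup_least D)
    moreover have "0 \<le> sup ?s ?h - ?h"
      by simp
    ultimately have "?s \<le> sup ?s ?h - ?h"
      by (rule sup_least)
    then have "?s + ?h \<le> sup ?s ?h"
      by (simp add: le_diff_eq)
    then have "inf ?s ?h \<le> 0"
      using add_eq_inf_sup[of ?s ?h] by simp
    then show "inf \<bar>?s\<bar> \<bar>g\<bar> \<le> 0"
      by simp
  qed simp
  have neg: "sup (- Sup D) 0 \<in> disjoint_complement S"
  proof (rule disjoint_complement_mono)
    show "d0 \<in> disjoint_complement S" using d0 D by auto
    have "- Sup D \<le> - d0" using d0 D by (simp add: cSup_upper)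
    also have "\<dots> \<le> \<bar>d0\<bar>" by (rule abs_ge_minus_self)
    finally show "\<bar>sup (- Sup D) 0\<bar> \<le> \<bar>d0\<bar>" by simp
  qed
  have "Sup D = ?s - sup (- Sup D) 0"
    by (rule eq_diff_pos_neg)
  then show "Sup D \<in> disjoint_complement S"
    using subspace_diff[OF subspace_disjoint_complement pos neg] by simp
qed

section \<open>Band projections\<close>

locale projection_onto_band =
  fixes P :: "'a::dedekind_complete_riesz_space \<Rightarrow> 'a" and B :: "'a set"
  assumes band: "band B"
    and in_band: "P f \<in> B"
    and diff_in_complement: "f - P f \<in> disjoint_complement B"
begin

lemma subspace: "subspace B"
  using band by (simp add: band_def order_ideal_def)

lemma eqI:
  assumes "x \<in> B" "f - x \<in> disjoint_complement B"
  shows "P f = x"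
proof -
  have 1: "P f - x \<in> B"
    using subspace in_band assms(1) by (rule subspace_diff)
  have "(f - x) - (f - P f) \<in> disjoint_complement B"
    by (rule subspace_diff[OF subspace_disjoint_complement assms(2) diff_in_complement])
  then have "P f - x \<in> disjoint_complement B"
    by simp
  with 1 have "inf (\<bar>P f - x\<bar>) (\<bar>P f - x\<bar>) = 0"
    by (simp only: disjoint_complement_def) blast
  then show ?thesis by simp
qed

lemma diff: "P (f - g) = P f - P g"
proof (rule eqI)
  show "P f - P g \<in> B"
    using subspace in_band in_band by (rule subspace_diff)
  have "(f - P f) - (g - P g) \<in> disjoint_complement B"
    by (rule subspace_diff[OF subspace_disjoint_complement]) (rule diff_in_complement)+
  then show "f - g - (P f - P g) \<in> disjoint_complement B"
    by (simp add: algebra_simps)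
qed

lemma idem: "P (P f) = P f"
  by (rule eqI) (auto intro: in_band subspace_0[OF subspace_disjoint_complement])

text \<open>
  If \<open>x\<close> and \<open>y\<close> are disjoint and \<open>x + y \<ge> 0\<close>, the negative part of \<open>x\<close> is dominated both by \<open>\<bar>x\<bar>\<close>
  and by \<open>\<bar>y\<bar>\<close>, hence is zero.
\<close>

lemma nonneg_le:
  assumes "0 \<le> f"
  shows "0 \<le> P f" "P f \<le> f"
proof -
  have *: "0 \<le> x" if "inf \<bar>x\<bar> \<bar>y\<bar> = 0" "0 \<le> x + y" for x y :: 'a
  proof -
    have "- x \<le> \<bar>x\<bar>" by (rule abs_ge_minus_self)
    moreover have "- x \<le> \<bar>y\<bar>"
    proof (rule order_trans)
      show "- x \<le> y" using add_left_mono[OF that(2), of "- x"] by (simp add: add.assoc[symmetric])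
    qed (rule abs_ge_self)
    ultimately have "- x \<le> inf \<bar>x\<bar> \<bar>y\<bar>" by simp
    then show ?thesis using that(1) by simp
  qed
  have dis: "inf (\<bar>f - P f\<bar>) (\<bar>P f\<bar>) = 0"
    using diff_in_complement[of f] in_band[of f] by (simp only: disjoint_complement_def) blast
  show "0 \<le> P f"
    by (rule *[of "P f" "f - P f"]) (use dis assms in \<open>simp_all add: inf.commute\<close>)
  have "0 \<le> f - P f"
    by (rule *[of "f - P f" "P f"]) (use dis assms in simp_all)
  then show "P f \<le> f" by simp
qed

lemma complement_iff: "f \<in> disjoint_complement B \<longleftrightarrow> P f = 0"
proof
  assume "f \<in> disjoint_complement B"
  then show "P f = 0" by (intro eqI) (simp_all add: subspace_0[OF subspace])
next
  assume "P f = 0"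
  then show "f \<in> disjoint_complement B" using diff_in_complement[of f] by simp
qed

end

lemma band_projection_iff: "band_projection P \<longleftrightarrow> (\<exists>B. projection_onto_band P B)"
  by (auto simp: band_projection_def projection_onto_band_def)

lemma band_projection_diff: "band_projection P \<Longrightarrow> P (f - g) = P f - P g"
  by (auto simp: band_projection_iff projection_onto_band.diff)

lemma band_projection_0: "band_projection P \<Longrightarrow> P 0 = 0"
  using band_projection_diff[of P 0 0] by simp

lemma band_projection_idem: "band_projection P \<Longrightarrow> P (P f) = P f"
  by (auto simp: band_projection_iff projection_onto_band.idem)

lemma band_projection_nonneg: "band_projection P \<Longrightarrow> 0 \<le> f \<Longrightarrow> 0 \<le> P f"
  by (auto simp: band_projection_iff projection_onto_band.nonneg_le)

lemma band_projection_le: "band_projection P \<Longrightarrow> 0 \<le> f \<Longrightarrow> P f \<le> f"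
  by (auto simp: band_projection_iff projection_onto_band.nonneg_le)

lemma band_projection_mono: "band_projection P \<Longrightarrow> f \<le> g \<Longrightarrow> P f \<le> P g"
  using band_projection_nonneg[of P "g - f"] by (simp add: band_projection_diff)

lemma band_projection_antisym:
  assumes "band_projection P" "band_projection Q" "operator_le P Q" "operator_le Q P"
  shows "P = Q"
proof
  fix f
  have "P g = Q g" if "0 \<le> g" for g
    using assms(3,4) that by (auto simp: operator_le_def intro: antisym)
  then have "P (sup f 0 - sup (- f) 0) = Q (sup f 0 - sup (- f) 0)"
    using assms(1,2)[THEN band_projection_diff] by (simp del: diff_sup_eq_inf diff_inf_eq_sup)
  then show "P f = Q f"
    using eq_diff_pos_neg[of f] by simp
qed

text \<open>
  The pointwise supremum is the projection onto the band disjoint from \<open>C\<close>, the common kernel of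
  the family. On the positive cone \<open>f - (SUP P\<in>\<P>. P f)\<close> lies in \<open>C\<close>, being between \<open>0\<close> and each
  \<open>f - P f\<close>.
\<close>

lemma band_projection_pointwise_Sup:
  fixes \<P> :: "('a::dedekind_complete_riesz_space \<Rightarrow> 'a) set"
  assumes ne: "\<P> \<noteq> {}" and bp: "\<And>P. P \<in> \<P> \<Longrightarrow> band_projection P"
  obtains Q where "band_projection Q" "\<And>f. 0 \<le> f \<Longrightarrow> Q f = (SUP P\<in>\<P>. P f)"
proof
  define C where "C = {f. \<forall>P\<in>\<P>. P f = 0}"
  define s where "s f = (SUP P\<in>\<P>. P f)" for f
  define Q where "Q f = s (sup f 0) - s (sup (- f) 0)" for f
  have bdd: "bdd_above ((\<lambda>P. P f) ` \<P>)" if "0 \<le> f" for f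
    using that by (auto intro!: bdd_aboveI[of _ f] band_projection_le[OF bp])
  have s_band: "s f \<in> disjoint_complement C" if f: "0 \<le> f" for f
  proof -
    have "P f \<in> disjoint_complement C" if P: "P \<in> \<P>" for P
    proof -
      obtain B where "projection_onto_band P B"
        using bp[OF P] by (auto simp: band_projection_iff)
      then interpret projection_onto_band P B .
      show ?thesis
        unfolding disjoint_complement_def
      proof (intro CollectI ballI)
        fix c assume "c \<in> C"
        then have "c \<in> disjoint_complement B"
          using P by (simp add: complement_iff C_def)
        then have "inf (\<bar>c\<bar>) (\<bar>P f\<bar>) = 0"
          using in_band by (auto simp: disjoint_complement_def)
        then show "inf (\<bar>P f\<bar>) (\<bar>c\<bar>) = 0"
          by (simp add: inf.commute)
      qed
    qed
    then have "(\<lambda>P. P f) ` \<P> \<subseteq> disjoint_complement C" by auto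
    then show ?thesis
      using band_disjoint_complement[of C] bdd[OF f] ne by (auto simp: band_def s_def)
  qed
  have s_ker: "f - s f \<in> C" if f: "0 \<le> f" for f
    unfolding C_def
  proof (intro CollectI ballI antisym)
    fix P assume P: "P \<in> \<P>"
    have "P f \<le> s f"
      unfolding s_def by (rule cSUP_upper[OF P bdd[OF f]])
    then have "P (f - s f) \<le> P (f - P f)"
      by (intro band_projection_mono[OF bp[OF P]]) simp
    also have "\<dots> = 0"
      by (simp add: band_projection_diff band_projection_idem bp P)
    finally show "P (f - s f) \<le> 0" .
    have "s f \<le> f"
      unfolding s_def by (rule cSUP_least[OF ne]) (rule band_projection_le[OF bp f])
    then show "0 \<le> P (f - s f)"
      by (intro band_projection_nonneg[OF bp[OF P]]) simp
  qed
  have double: "C \<subseteq> disjoint_complement (disjoint_complement C)"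
    by (auto simp: disjoint_complement_def inf.commute)
  have "Q f \<in> disjoint_complement C" for f
    unfolding Q_def by (intro subspace_diff subspace_disjoint_complement s_band sup_ge2)
  moreover have "f - Q f \<in> disjoint_complement (disjoint_complement C)" for f
  proof -
    have "(sup f 0 - s (sup f 0)) - (sup (- f) 0 - s (sup (- f) 0))
        \<in> disjoint_complement (disjoint_complement C)"
      by (rule subspace_diff[OF subspace_disjoint_complement])
        (use s_ker double in auto)
    moreover have "(sup f 0 - s (sup f 0)) - (sup (- f) 0 - s (sup (- f) 0))
        = (sup f 0 - sup (- f) 0) - Q f"
      by (simp add: Q_def)
    ultimately show ?thesis
      using eq_diff_pos_neg[of f] by simp
  qed
  ultimately show "band_projection Q"
    unfolding band_projection_def using band_disjoint_complement by blast
  fix f :: 'a assume f: "0 \<le> f"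
  have "s 0 = (SUP P\<in>\<P>. 0)"
    unfolding s_def by (intro SUP_cong) (auto simp: band_projection_0 bp)
  then have "s 0 = 0" using ne by simp
  then have "Q f = s f"
    using f by (simp add: Q_def sup.absorb1 sup.absorb2)
  then show "Q f = (SUP P\<in>\<P>. P f)" by (simp add: s_def)
qed

lemma band_projection_Sup_apply:
  fixes \<P> :: "('a::dedekind_complete_riesz_space \<Rightarrow> 'a) set"
  assumes ne: "\<P> \<noteq> {}" and bp: "\<And>P. P \<in> \<P> \<Longrightarrow> band_projection P" and f: "0 \<le> f"
  shows "band_projection_Sup \<P> f = (SUP P\<in>\<P>. P f)"
proof -
  obtain Q where Q: "band_projection Q" "\<And>f. 0 \<le> f \<Longrightarrow> Q f = (SUP P\<in>\<P>. P f)"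
    using band_projection_pointwise_Sup[of \<P>] ne bp by auto
  have bdd: "bdd_above ((\<lambda>P. P f) ` \<P>)" if "0 \<le> f" for f
    using that by (auto intro!: bdd_aboveI[of _ f] band_projection_le[OF bp])
  have upper: "\<forall>P\<in>\<P>. operator_le P Q"
    using Q(2) bdd by (auto simp: operator_le_def intro: cSUP_upper)
  have least: "operator_le Q R" if "\<forall>P\<in>\<P>. operator_le P R" for R
    using Q(2) that ne by (auto simp: operator_le_def intro!: cSUP_least)
  have "band_projection_Sup \<P> = Q"
    unfolding band_projection_Sup_def
    by (rule the_equality) (use Q(1) upper least in \<open>auto intro: band_projection_antisym\<close>)
  then show ?thesis using Q(2) f by simp
qed

lemma band_projection_zero: "band_projection (\<lambda>f::'a::dedekind_complete_riesz_space. 0)"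
proof -
  have "disjoint_complement UNIV = {0::'a}"
  proof -
    have "f = 0" if "f \<in> disjoint_complement UNIV" for f :: 'a
    proof -
      have "inf \<bar>f\<bar> \<bar>f\<bar> = 0" using that by (simp only: disjoint_complement_def) blast
      then show ?thesis by simp
    qed
    then show ?thesis
      using subspace_0[OF subspace_disjoint_complement[of "UNIV :: 'a set"]] by blast
  qed
  then have "band {0::'a}"
    using band_disjoint_complement[of "UNIV :: 'a set"] by simp
  then show ?thesis
    unfolding band_projection_def
    by (intro exI[of _ "{0}"]) (auto simp: disjoint_complement_def inf.absorb2)
qed

lemma band_projection_Inf_eq_zero:
  fixes \<P> :: "('a::dedekind_complete_riesz_space \<Rightarrow> 'a) set"
  assumes "\<And>P f. P \<in> \<P> \<Longrightarrow> 0 \<le> f \<Longrightarrow> 0 \<le> P f"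
    and "\<And>R. band_projection R \<Longrightarrow> \<forall>P\<in>\<P>. operator_le R P \<Longrightarrow> R = (\<lambda>f. 0)"
  shows "band_projection_Inf \<P> = (\<lambda>f. 0)"
  unfolding band_projection_Inf_def
  by (rule the_equality)
    (use assms band_projection_zero in \<open>auto simp: operator_le_def\<close>)

text \<open>
  The complement of the band is itself a band; once it contains the weak order unit it is the
  whole space.
\<close>

lemma band_projection_eq_zero:
  assumes "band_projection R" "weak_order_unit e" "R e = 0"
  shows "R = (\<lambda>f. 0)"
proof
  fix f
  obtain B where "projection_onto_band R B"
    using assms(1) by (auto simp: band_projection_iff)
  then interpret projection_onto_band R B .
  have "{e} \<subseteq> disjoint_complement B"
    using assms(3) by (simp add: complement_iff)
  then have "band hull {e} \<subseteq> disjoint_complement B"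
    using band_disjoint_complement by (rule hull_minimal)
  then have "f \<in> disjoint_complement B"
    using assms(2) by (auto simp: weak_order_unit_def)
  then show "R f = 0" by (simp add: complement_iff)
qed

section \<open>The Borel--Cantelli argument\<close>

lemma positive_operator_mono:
  assumes "positive_operator T" "f \<le> g"
  shows "T f \<le> T g"
proof -
  have "0 \<le> T (g - f)" using assms by (simp add: positive_operator_def)
  then show ?thesis using assms by (simp add: positive_operator_def linear_diff)
qed

text \<open>
  Order continuity speaks of sets decreasing to \<open>0\<close>; here it is applied to the differences between
  the supremum and the \<open>g m\<close>.
\<close>

lemma order_continuous_SUP_le:
  fixes g :: "nat \<Rightarrow> 'a::dedekind_complete_riesz_space"
  assumes T: "positive_operator T" "order_continuous T"
    and g: "mono g" "bdd_above (range g)"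
    and le: "\<And>m. T (g m) \<le> b"
  shows "T (SUP m. g m) \<le> b"
proof -
  let ?s = "SUP m. g m"
  let ?D = "range (\<lambda>m. ?s - g m)"
  have ub: "g m \<le> ?s" for m using g by (intro cSUP_upper) auto
  have "\<forall>f\<in>?D. \<forall>h\<in>?D. \<exists>d\<in>?D. d \<le> f \<and> d \<le> h"
  proof (intro ballI)
    fix f h assume "f \<in> ?D" "h \<in> ?D"
    then obtain i j where "f = ?s - g i" "h = ?s - g j" by auto
    then show "\<exists>d\<in>?D. d \<le> f \<and> d \<le> h"
      using monoD[OF g(1), of i "max i j"] monoD[OF g(1), of j "max i j"]
      by (intro bexI[of _ "?s - g (max i j)"]) auto
  qed
  moreover have "bdd_below ?D"
    by (rule bdd_belowI[of _ 0]) (use ub in auto)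
  moreover have "Inf ?D = 0"
  proof (rule cInf_eq_non_empty)
    fix y assume y: "\<And>x. x \<in> ?D \<Longrightarrow> y \<le> x"
    have "g m \<le> ?s - y" for m
      using y[of "?s - g m"] by (simp add: algebra_simps)
    then have "?s \<le> ?s - y" by (intro cSUP_least) auto
    then show "y \<le> 0" by simp
  qed (use ub in auto)
  ultimately have Inf: "Inf (T ` ?D) = 0"
    using T(2) unfolding order_continuous_def by blast
  have lin: "linear T" using T(1) by (simp add: positive_operator_def)
  have "T ?s - b \<le> Inf (T ` ?D)"
  proof (rule cInf_greatest)
    fix x assume "x \<in> T ` ?D"
    then obtain m where "x = T ?s - T (g m)" by (auto simp: linear_diff[OF lin])
    then show "T ?s - b \<le> x" using le[of m] by simp
  qed simp
  then show ?thesis using Inf by simp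
qed

lemma le_sum_add_of_le_add_Suc:
  fixes p d :: "nat \<Rightarrow> 'a::ordered_ab_group_add"
  assumes step: "\<And>n. p n \<le> d n + p (Suc n)" and "n \<le> m"
  shows "p n \<le> (\<Sum>j\<in>{n..<m}. d j) + p m"
  using \<open>n \<le> m\<close>
proof (induction m rule: dec_induct)
  case (step m)
  have "p n \<le> (\<Sum>j\<in>{n..<m}. d j) + p m" by fact
  also have "\<dots> \<le> (\<Sum>j\<in>{n..<m}. d j) + (d m + p (Suc m))"
    using assms(1) by (rule add_left_mono)
  also have "\<dots> = (\<Sum>j\<in>{n..<Suc m}. d j) + p (Suc m)"
    using step by (simp add: add.assoc)
  finally show ?case .
qed simp

text \<open>
  The sequence \<open>p\<close> may rise freely, but each descent is paid for by \<open>d\<close>. Since \<open>T (p n)\<close> has limit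
  inferior \<open>0\<close>, whatever height is reached from index \<open>k\<close> on has to be given up again later, so
  after applying \<open>T\<close> it is bounded by the remainder of the series \<open>\<Sum>n. T (d n)\<close>.
\<close>

lemma limsup_components_eq_0:
  fixes p d :: "nat \<Rightarrow> 'a::dedekind_complete_riesz_space"
  assumes T: "positive_operator T" "order_continuous T" "strictly_positive T"
    and p: "\<And>n. 0 \<le> p n" "\<And>n. p n \<le> e"
    and d: "\<And>n. 0 \<le> d n" "\<And>n. p n \<le> d n + p (Suc n)"
    and lim: "order_liminf (\<lambda>n. T (p n)) = 0"
    and bdd: "bdd_above (range (\<lambda>N. \<Sum>n\<le>N. T (d n)))"
  shows "(INF k. SUP n\<in>{k..}. p n) = 0"
proof -
  have lin: "linear T" using T(1) by (simp add: positive_operator_def)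
  define S where "S k = (SUP n\<in>{k..}. p n)" for k
  define s where "s N = (\<Sum>n\<le>N. T (d n))" for N
  define \<sigma> where "\<sigma> = (SUP N. s N)"
  have s_le: "s N \<le> \<sigma>" for N
    unfolding \<sigma>_def using bdd by (intro cSUP_upper) (auto simp: s_def)
  have bddp: "bdd_above (p ` A)" for A
    using p(2) by (auto intro!: bdd_aboveI[of _ e])
  have p_le_S: "p n \<le> S k" if "k \<le> n" for k n
    unfolding S_def using that bddp by (intro cSUP_upper) auto
  have S_nonneg: "0 \<le> S k" for k
    using p(1)[of k] p_le_S[of k k] by simp
  \<comment> \<open>This is what makes the last summand \<open>T (p M)\<close> vanish in the estimate of \<open>T (g m)\<close> below.\<close>
  have liminf: "x \<le> 0" if x: "\<And>m. M \<le> m \<Longrightarrow> x \<le> T (p m)" for x M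
  proof -
    have low: "bdd_below ((\<lambda>n. T (p n)) ` A)" for A
      using T(1) p(1) by (auto intro!: bdd_belowI[of _ 0] simp: positive_operator_def)
    have "(INF n\<in>{k..}. T (p n)) \<le> T e" for k
    proof -
      have "(INF n\<in>{k..}. T (p n)) \<le> T (p k)" by (intro cINF_lower low) simp
      also have "\<dots> \<le> T e" by (rule positive_operator_mono[OF T(1) p(2)])
      finally show ?thesis .
    qed
    then have up: "bdd_above (range (\<lambda>k. INF n\<in>{k..}. T (p n)))"
      by (auto intro!: bdd_aboveI[of _ "T e"])
    have "x \<le> (INF n\<in>{M..}. T (p n))" using x by (intro cINF_greatest) auto
    also have "\<dots> \<le> order_liminf (\<lambda>n. T (p n))"
      unfolding order_liminf_def using up by (intro cSUP_upper) auto
    finally show ?thesis using lim by simp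
  qed
  have TS: "T (S (Suc k)) \<le> \<sigma> - s k" for k
  proof -
    define g where "g m = (SUP n\<in>{Suc k..Suc k + m}. p n)" for m
    have "mono g"
      unfolding g_def by (intro monoI cSUP_subset_mono bddp) auto
    have g_le: "g m \<le> S (Suc k)" for m
      unfolding g_def using p_le_S by (intro cSUP_least) auto
    have bddg: "bdd_above (range g)"
      using g_le by (auto intro!: bdd_aboveI[of _ "S (Suc k)"])
    have "p n \<le> (SUP m. g m)" if "Suc k \<le> n" for n
    proof -
      have "p n \<le> g (n - Suc k)"
        unfolding g_def using that by (intro cSUP_upper bddp) auto
      also have "\<dots> \<le> (SUP m. g m)" using bddg by (intro cSUP_upper) auto
      finally show ?thesis .
    qed
    then have "S (Suc k) \<le> (SUP m. g m)"
      unfolding S_def by (intro cSUP_least) auto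
    then have "T (S (Suc k)) \<le> T (SUP m. g m)"
      by (rule positive_operator_mono[OF T(1)])
    also have "\<dots> \<le> \<sigma> - s k"
    proof (rule order_continuous_SUP_le[OF T(1,2) \<open>mono g\<close> bddg])
      fix m
      have "T (g m) - (\<sigma> - s k) \<le> T (p M)" if M: "Suc k + m \<le> M" for M
      proof -
        have "g m \<le> (\<Sum>j\<in>{Suc k..<M}. d j) + p M"
          unfolding g_def
        proof (intro cSUP_least)
          fix n assume n: "n \<in> {Suc k..Suc k + m}"
          have "p n \<le> (\<Sum>j\<in>{n..<M}. d j) + p M"
            using n M d(2) by (intro le_sum_add_of_le_add_Suc) auto
          also have "\<dots> \<le> (\<Sum>j\<in>{Suc k..<M}. d j) + p M"
            using n d(1) by (intro add_right_mono sum_mono2) auto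
          finally show "p n \<le> (\<Sum>j\<in>{Suc k..<M}. d j) + p M" .
        qed simp
        then have "T (g m) \<le> T ((\<Sum>j\<in>{Suc k..<M}. d j) + p M)"
          by (rule positive_operator_mono[OF T(1)])
        also have "\<dots> = (\<Sum>j\<in>{Suc k..<M}. T (d j)) + T (p M)"
          by (simp add: linear_add[OF lin] linear_sum[OF lin])
        also have "\<dots> = s (M - 1) - s k + T (p M)"
        proof -
          have "{..M - 1} = {..k} \<union> {Suc k..<M}" using M by auto
          then have "s (M - 1) = s k + (\<Sum>j\<in>{Suc k..<M}. T (d j))"
            unfolding s_def by (simp only:) (rule sum.union_disjoint; auto)
          then show ?thesis by simp
        qed
        also have "\<dots> \<le> \<sigma> - s k + T (p M)"
          using s_le[of "M - 1"] by (intro add_right_mono diff_right_mono)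
        finally show ?thesis by (simp add: algebra_simps)
      qed
      then have "T (g m) - (\<sigma> - s k) \<le> 0" by (rule liminf)
      then show "T (g m) \<le> \<sigma> - s k" by simp
    qed
    finally show ?thesis .
  qed
  define L where "L = (INF k. S k)"
  have bddS: "bdd_below (range S)"
    using S_nonneg by (auto intro!: bdd_belowI[of _ 0])
  have L: "0 \<le> L" "L \<le> S k" for k
    unfolding L_def using S_nonneg bddS by (auto intro: cINF_greatest cINF_lower)
  \<comment> \<open>Since \<open>\<sigma>\<close> is the least upper bound of \<open>s\<close>, the remainders \<open>\<sigma> - s k\<close> have infimum \<open>0\<close>.\<close>
  have "s k \<le> \<sigma> - T L" for k
  proof -
    have "T L \<le> T (S (Suc k))" by (rule positive_operator_mono[OF T(1) L(2)])
    also have "\<dots> \<le> \<sigma> - s k" by (rule TS)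
    finally show ?thesis by (simp add: algebra_simps)
  qed
  then have "\<sigma> \<le> \<sigma> - T L" unfolding \<sigma>_def by (intro cSUP_least) auto
  moreover have "0 \<le> T L" using T(1) L by (simp add: positive_operator_def)
  ultimately have "T L = 0" by (simp add: antisym)
  then have "L = 0" using T(3) L by (simp add: strictly_positive_def)
  then show ?thesis by (simp add: L_def S_def)
qed

theorem theorem4p2:
  fixes T :: "'a::dedekind_complete_riesz_space \<Rightarrow> 'a"
    and e :: 'a
    and P :: "nat \<Rightarrow> 'a \<Rightarrow> 'a"
  assumes "conditional_expectation T"
    and "strictly_positive T"
    and "weak_order_unit e"
    and "e = T e"
    and "\<And>n. band_projection (P n)"
    and "order_liminf (\<lambda>n. T (P n e)) = 0"
    and "order_summable (\<lambda>n. T (P n (e - P (Suc n) e)))"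
  shows "band_projection_limsup P = (\<lambda>f. 0)"
proof -
  note bp = assms(5)
  have e: "0 \<le> e" using assms(3) by (simp add: weak_order_unit_def)
  have pn: "0 \<le> P n e" "P n e \<le> e" for n
    using band_projection_nonneg[OF bp e] band_projection_le[OF bp e] by auto
  have lim: "(INF k. SUP n\<in>{k..}. P n e) = 0"
  proof (rule limsup_components_eq_0[where T = T and e = e
        and d = "\<lambda>n. P n (e - P (Suc n) e)"])
    show "0 \<le> P n (e - P (Suc n) e)" for n
      using pn by (intro band_projection_nonneg[OF bp]) simp
    show "P n e \<le> P n (e - P (Suc n) e) + P (Suc n) e" for n
      using band_projection_le[OF bp pn(1), of n "Suc n"]
      by (simp add: band_projection_diff[OF bp] algebra_simps)
    show "bdd_above (range (\<lambda>N. \<Sum>n\<le>N. T (P n (e - P (Suc n) e))))"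
      using assms(7) by (simp add: order_summable_def order_convergent_def)
  qed (use assms pn in \<open>auto simp: conditional_expectation_def\<close>)
  define Q where "Q k = band_projection_Sup (P ` {k..})" for k
  have Q: "Q k f = (SUP n\<in>{k..}. P n f)" if "0 \<le> f" for k f
    unfolding Q_def using band_projection_Sup_apply[of "P ` {k..}" f] bp that
    by (auto simp: image_image)
  have "band_projection_Inf (range Q) = (\<lambda>f. 0)"
  proof (rule band_projection_Inf_eq_zero)
    fix R f assume "R \<in> range Q" and f: "0 \<le> (f::'a)"
    then obtain k where k: "R = Q k" by auto
    have "bdd_above ((\<lambda>n. P n f) ` {k..})"
      using band_projection_le[OF bp f] by (auto intro!: bdd_aboveI[of _ f])
    then have "P k f \<le> R f" using Q[OF f] k by (auto intro: cSUP_upper)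
    then show "0 \<le> R f" using band_projection_nonneg[OF bp f, of k] by simp
  next
    fix R assume R: "band_projection R" "\<forall>S\<in>range Q. operator_le R S"
    then have "R e \<le> (SUP n\<in>{k..}. P n e)" for k
      using Q[OF e, of k] e by (metis operator_le_def rangeI)
    then have "R e \<le> (INF k. SUP n\<in>{k..}. P n e)" by (intro cINF_greatest) auto
    then have "R e = 0"
      using lim band_projection_nonneg[OF R(1) e] by (simp add: antisym)
    then show "R = (\<lambda>f. 0)" by (rule band_projection_eq_zero[OF R(1) assms(3)])
  qed
  then show ?thesis by (simp add: band_projection_limsup_def Q_def)
qed

end
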